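(* Let $m,n$ be non-negative integers with $(m,n)\neq(0,0)$ and let $R$ be an abelian $(m,n)$-regularly nil clean ring. Then $R$ is regularly nil clean.
   Context: All rings are associative with identity (not necessarily commutative). A ring is called abelian if all its idempotents are central. A ring $R$ is called regularly nil clean if for every $a\in R$ there exists an idempotent $e\in Ra$ such that $a(1-e)$ is nilpotent. For non-negative integers $m,n$, a ring $R$ is called $(m,n)$-regularly nil clean if for every $a\in R$ there exists an idempotent $e\in a^mRa^n$ such that $a^m(1-e)a^n$ is nilpotent (with the convention $a^0=1$). *)

theory Defs
  imports "HOL-Algebra.Ring"
begin

text \<open>The predicates below are meant for an \<^emph>\<open>arbitrary\<close> structure satisfying
  \<^locale>\<open>ring\<close>: associative with identity, not necessarily commutative, and the zero
  ring is allowed.\<close>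

definition ring_idempotent :: "('a, 'b) ring_scheme \<Rightarrow> 'a \<Rightarrow> bool" where
  "ring_idempotent R e \<longleftrightarrow> e \<in> carrier R \<and> e \<otimes>\<^bsub>R\<^esub> e = e"

definition ring_nilpotent :: "('a, 'b) ring_scheme \<Rightarrow> 'a \<Rightarrow> bool" where
  "ring_nilpotent R x \<longleftrightarrow> x \<in> carrier R \<and> (\<exists>k::nat. k \<ge> 1 \<and> x [^]\<^bsub>R\<^esub> k = \<zero>\<^bsub>R\<^esub>)"

definition ring_central :: "('a, 'b) ring_scheme \<Rightarrow> 'a \<Rightarrow> bool" where
  "ring_central R x \<longleftrightarrow> x \<in> carrier R \<and> (\<forall>y \<in> carrier R. x \<otimes>\<^bsub>R\<^esub> y = y \<otimes>\<^bsub>R\<^esub> x)"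

text \<open>Abelian here means that all idempotents are central; it does not mean commutative.\<close>

definition abelian_ring :: "('a, 'b) ring_scheme \<Rightarrow> bool" where
  "abelian_ring R \<longleftrightarrow> (\<forall>e. ring_idempotent R e \<longrightarrow> ring_central R e)"

definition regularly_nil_clean :: "('a, 'b) ring_scheme \<Rightarrow> bool" where
  "regularly_nil_clean R \<longleftrightarrow>
    (\<forall>a \<in> carrier R. \<exists>e \<in> {r \<otimes>\<^bsub>R\<^esub> a | r. r \<in> carrier R}.
       ring_idempotent R e \<and> ring_nilpotent R (a \<otimes>\<^bsub>R\<^esub> (\<one>\<^bsub>R\<^esub> \<ominus>\<^bsub>R\<^esub> e)))"

definition mn_regularly_nil_clean :: "nat \<Rightarrow> nat \<Rightarrow> ('a, 'b) ring_scheme \<Rightarrow> bool" where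
  "mn_regularly_nil_clean m n R \<longleftrightarrow>
    (\<forall>a \<in> carrier R.
       \<exists>e \<in> {a [^]\<^bsub>R\<^esub> m \<otimes>\<^bsub>R\<^esub> r \<otimes>\<^bsub>R\<^esub> a [^]\<^bsub>R\<^esub> n | r. r \<in> carrier R}.
       ring_idempotent R e \<and>
       ring_nilpotent R (a [^]\<^bsub>R\<^esub> m \<otimes>\<^bsub>R\<^esub> (\<one>\<^bsub>R\<^esub> \<ominus>\<^bsub>R\<^esub> e) \<otimes>\<^bsub>R\<^esub> a [^]\<^bsub>R\<^esub> n))"

end

theory Submission
  imports Defs
begin

text \<open>Since \<open>e\<close> is central, a power of \<open>a (1 - e)\<close> equals \<open>a\<^sup>m (1 - e) a\<^sup>n\<close>, so the only
  issue is that \<open>e\<close> lies in \<open>Ra\<close>. For \<open>n > 0\<close> this is immediate. For \<open>n = 0\<close> we have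
  \<open>e = a s\<close>, and the idempotent \<open>f = s e a\<close> is central as well, whence
  \<open>e = e a s = a f s = f e\<close> lies in \<open>Ra\<close>.\<close>

context ring
begin

lemma idempotent_pow:
  assumes "ring_idempotent R g" and "k \<ge> 1"
  shows "g [^] (k::nat) = g"
  using assms(2)
proof (induction k rule: dec_induct)
  case base
  then show ?case using assms(1) by (simp add: ring_idempotent_def)
next
  case (step k)
  then show ?case using assms(1) by (simp add: ring_idempotent_def)
qed

lemma idempotent_one_minus:
  assumes "ring_idempotent R e"
  shows "ring_idempotent R (\<one> \<ominus> e)"
proof -
  have e: "e \<in> carrier R" "e \<otimes> e = e"
    using assms by (auto simp: ring_idempotent_def)
  have "(\<one> \<ominus> e) \<otimes> (\<one> \<ominus> e) = \<one> \<ominus> e"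
    using e by (simp add: minus_eq l_distr r_distr l_minus r_minus r_neg)
  then show ?thesis
    using e by (simp add: ring_idempotent_def)
qed

lemma idempotent_right_multiple_imp_left_multiple:
  assumes ab: "abelian_ring R" and a: "a \<in> carrier R" and s: "s \<in> carrier R"
    and idem: "ring_idempotent R (a \<otimes> s)"
  obtains r where "r \<in> carrier R" and "a \<otimes> s = r \<otimes> a"
proof -
  define e where "e = a \<otimes> s"
  have e: "e \<in> carrier R" and ee: "e \<otimes> e = e"
    and cent: "\<And>y. y \<in> carrier R \<Longrightarrow> e \<otimes> y = y \<otimes> e"
    using ab idem by (auto simp: abelian_ring_def ring_central_def ring_idempotent_def e_def)
  define f where "f = s \<otimes> e \<otimes> a"
  have f: "f \<in> carrier R"
    using a s e by (simp add: f_def)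
  \<comment> \<open>The inner \<open>a \<otimes> s\<close> is \<open>e\<close> again, so the square
    collapses to \<open>s \<otimes> e \<otimes> a\<close> by idempotence of \<open>e\<close>; being
    idempotent, \<open>f\<close> is then central and commutes with \<open>a\<close>.\<close>
  have "f \<otimes> f = s \<otimes> (e \<otimes> (a \<otimes> s) \<otimes> e) \<otimes> a"
    using a s e by (simp add: f_def m_assoc)
  also have "\<dots> = f"
    using ee by (simp add: f_def flip: e_def)
  finally have "f \<otimes> a = a \<otimes> f"
    using ab a f by (simp add: abelian_ring_def ring_central_def ring_idempotent_def)
  have "f \<otimes> e = f \<otimes> a \<otimes> s"
    using a s f by (simp add: e_def m_assoc)
  also have "\<dots> = (a \<otimes> s) \<otimes> e \<otimes> (a \<otimes> s)"
    using a s e \<open>f \<otimes> a = a \<otimes> f\<close> by (simp add: f_def m_assoc)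
  also have "\<dots> = e"
    using ee by (simp flip: e_def)
  finally have "e = f \<otimes> e" ..
  \<comment> \<open>Expanding \<open>f\<close> leaves the factor \<open>e\<close> to the right of
    \<open>a\<close>; centrality of \<open>e\<close> moves it across, so that \<open>a\<close>
    becomes the last factor.\<close>
  also have "\<dots> = s \<otimes> e \<otimes> (a \<otimes> e)"
    using a s e by (simp add: f_def m_assoc)
  also have "\<dots> = (s \<otimes> e \<otimes> e) \<otimes> a"
    unfolding cent[OF a, symmetric] using a s e by (simp add: m_assoc)
  finally have "a \<otimes> s = (s \<otimes> e \<otimes> e) \<otimes> a"
    unfolding e_def .
  then show thesis
    using s e by (intro that[of "s \<otimes> e \<otimes> e"]) simp_all
qed

text \<open>Centrality of \<open>g\<close> gathers the powers of \<open>a\<close> into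
  \<open>a [^] (m + n) \<otimes> g\<close>. As \<open>g\<close> equals all its positive powers, the
  k-th power of this is \<open>(a \<otimes> g) [^] ((m + n) * k)\<close>, so an exponent killing the
  first element yields one killing \<open>a \<otimes> g\<close>.\<close>

lemma nilpotent_mult_central_idempotent:
  fixes m n :: nat
  assumes a: "a \<in> carrier R" and g: "ring_idempotent R g" "ring_central R g"
    and mn: "m + n > 0"
    and nil: "ring_nilpotent R (a [^] m \<otimes> g \<otimes> a [^] n)"
  shows "ring_nilpotent R (a \<otimes> g)"
proof -
  have gc: "g \<in> carrier R" and cent: "\<And>y. y \<in> carrier R \<Longrightarrow> y \<otimes> g = g \<otimes> y"
    using g by (auto simp: ring_central_def)
  obtain k :: nat where k: "k \<ge> 1" and zero: "(a [^] m \<otimes> g \<otimes> a [^] n) [^] k = \<zero>"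
    using nil by (auto simp: ring_nilpotent_def)
  \<comment> \<open>Positivity serves twice: to absorb the power of \<open>g\<close> into
    \<open>g\<close>, and to make this exponent a legitimate witness of nilpotency.\<close>
  have pos: "(m + n) * k \<ge> 1"
    using k mn by (simp add: Suc_le_eq)
  have "a [^] m \<otimes> g \<otimes> a [^] n = a [^] (m + n) \<otimes> g"
    using a gc cent[of "a [^] n"] by (simp add: m_assoc flip: nat_pow_mult)
  then have "(a [^] m \<otimes> g \<otimes> a [^] n) [^] k = a [^] ((m + n) * k) \<otimes> g"
    using a gc
    by (simp only: pow_mult_distrib[OF cent] nat_pow_closed nat_pow_pow idempotent_pow[OF g(1) k])
  also have "\<dots> = (a \<otimes> g) [^] ((m + n) * k)"
    using a gc by (simp only: pow_mult_distrib[OF cent] idempotent_pow[OF g(1) pos])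
  finally show ?thesis
    using zero a gc pos unfolding ring_nilpotent_def by (intro conjI exI[of _ "(m + n) * k"]) auto
qed

end

theorem corollary2p11:
  fixes R :: "('a, 'b) ring_scheme" and m n :: nat
  assumes "ring R"
    and "(m, n) \<noteq> (0, 0)"
    and "abelian_ring R"
    and "mn_regularly_nil_clean m n R"
  shows "regularly_nil_clean R"
  unfolding regularly_nil_clean_def
proof
  interpret ring R by fact
  fix a assume a: "a \<in> carrier R"
  let ?E = "\<lambda>r. a [^]\<^bsub>R\<^esub> m \<otimes>\<^bsub>R\<^esub> r \<otimes>\<^bsub>R\<^esub> a [^]\<^bsub>R\<^esub> n"
  obtain r where r: "r \<in> carrier R" and idem: "ring_idempotent R (?E r)"
    and nil: "ring_nilpotent R (?E (\<one>\<^bsub>R\<^esub> \<ominus>\<^bsub>R\<^esub> ?E r))"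
    using assms(4) a unfolding mn_regularly_nil_clean_def by blast
  \<comment> \<open>The role of \<open>g\<close> is played by the complementary idempotent
    \<open>1 - e\<close>, central because the ring is abelian.\<close>
  have "ring_nilpotent R (a \<otimes>\<^bsub>R\<^esub> (\<one>\<^bsub>R\<^esub> \<ominus>\<^bsub>R\<^esub> ?E r))"
    using nilpotent_mult_central_idempotent[OF a _ _ _ nil] idempotent_one_minus[OF idem] assms(2,3)
    by (auto simp: abelian_ring_def)
  moreover have "\<exists>t \<in> carrier R. ?E r = t \<otimes>\<^bsub>R\<^esub> a"
  proof (cases n)
    case (Suc n')
    \<comment> \<open>The witness is \<open>?E r\<close> with the rightmost factor \<open>a\<close>
      split off from the power.\<close>
    then show ?thesis
      using a r by (intro bexI[of _ "a [^]\<^bsub>R\<^esub> m \<otimes>\<^bsub>R\<^esub> r \<otimes>\<^bsub>R\<^esub> a [^]\<^bsub>R\<^esub> n'"]) (auto simp: m_assoc)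
  next
    case 0
    then obtain m' where "m = Suc m'"
      using assms(2) by (cases m) auto
    \<comment> \<open>Now the right-hand power is the identity, and \<open>nat_pow_Suc2\<close>
      peels \<open>a\<close> off on the left, giving the shape \<open>a \<otimes> s\<close> that the
      lemma on right multiples expects.\<close>
    then have e: "?E r = a \<otimes>\<^bsub>R\<^esub> (a [^]\<^bsub>R\<^esub> m' \<otimes>\<^bsub>R\<^esub> r)"
      using a r 0 by (simp only: nat_pow_Suc2 nat_pow_0 nat_pow_closed m_assoc m_closed r_one)
    have "a [^]\<^bsub>R\<^esub> m' \<otimes>\<^bsub>R\<^esub> r \<in> carrier R"
      using a r by simp
    from idempotent_right_multiple_imp_left_multiple[OF assms(3) a this] idem
    show ?thesis
      unfolding e by blast
  qed
  ultimately show "\<exists>e \<in> {r \<otimes>\<^bsub>R\<^esub> a | r. r \<in> carrier R}.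
      ring_idempotent R e \<and> ring_nilpotent R (a \<otimes>\<^bsub>R\<^esub> (\<one>\<^bsub>R\<^esub> \<ominus>\<^bsub>R\<^esub> e))"
    using idem by blast
qed

end
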